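(* Let $\mathbb{E}$ be an embedding of the graph $G$, and for each vertex $v$ of $G$ write $v=(s_v,\pi_v)_{q_v}$ and $D_v=s_v\circ\pi_v^{-1}$. Let $$T_1=\min_v\left\{-\left\lfloor\frac{deg(v)+1-\ell(\lambda(D_v))-q_v}{2}\right\rfloor\right\},\qquad T_2=\max_v\left\{\left\lfloor\frac{q_v-1}{2}\right\rfloor\right\},$$ where $v$ ranges over all vertices of $G$. Then $$g_{min}(G)\le g(\mathbb{E})+T_1\le g(\mathbb{E})+T_2\le g_{max}(G).$$
   Context: Graphs are finite and connected with at least one edge, loops and multiple edges allowed. An embedding is a 2-cell embedding on a closed orientable surface. Permutations are composed right to left, and fixed points count as cycles. An embedding $\mathbb{E}$ of $G$ with $e$ edges is encoded by a triple $(\alpha,\beta,\gamma)$ of permutations of the set $[2e]$ of half edges (each edge consists of two half edges): $\alpha$ is the fixed-point-free involution pairing the two half edges of each edge; the cycles of $\beta$ are the vertices, each cycle listing the half edges incident to that vertex in counterclockwise cyclic order; $\gamma=\alpha\beta$, and its cycles are the faces. Write $s=\gamma$, $\pi=\beta$. The genus $g=g(\mathbb{E})$ is given by $(\#\text{vertices})-(\#\text{edges})+(\#\text{faces})=2-2g$; $g_{min}(G)$ and $g_{max}(G)$ are the minimum and maximum genus of an embedding of $G$. For a vertex $v$, $H(v)$ is the set of half edges incident to $v$ and $deg(v)=|H(v)|$. A face is incident to $v$ if the corresponding cycle of $s$ contains an element of $H(v)$; $q_v$ is the number of faces incident to $v$. The pair $(s_v,\pi_v)_{q_v}$ consists of permutations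 of $H(v)$: $s_v$ (with $q_v$ cycles) is obtained from the $q_v$ cycles of $s$ incident to $v$ by deleting all elements not in $H(v)$, and $\pi_v$ is the restriction of $\pi$ to $H(v)$ (a single cycle). $\lambda(D_v)$ is the cycle-type of $D_v$ and $\ell(\lambda(D_v))$ its number of parts, i.e. the number of cycles of $D_v$ as a permutation of $H(v)$. *)

theory Defs
  imports
    "Graph_Theory.Digraph_Component"
    "Graph_Theory.Bidirected_Digraph"
    "HOL-Combinatorics.Orbits"
    "HOL-Library.Multiset"
begin

text \<open>
  A graph with loops and multiple edges is represented by its half edges: these are the arcs of a
  bidirected multigraph \<open>G\<close>, the half edge \<open>h\<close> being incident to the vertex \<open>tail G h\<close>, and the
  fixed-point-free involution \<open>\<alpha>\<close> on the arcs pairs the two half edges of each edge.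
  The two half edges of a loop both have the same tail.
\<close>

definition finite_connected_graph :: "('v, 'h) pre_digraph \<Rightarrow> ('h \<Rightarrow> 'h) \<Rightarrow> bool" where
  "finite_connected_graph G \<alpha> \<longleftrightarrow>
     fin_digraph G \<and> bidirected_digraph G \<alpha> \<and> connected G \<and> arcs G \<noteq> {}"

abbreviation half_edges_at :: "('v, 'h) pre_digraph \<Rightarrow> 'v \<Rightarrow> 'h set" where
  "half_edges_at G v \<equiv> out_arcs G v"

text \<open>
  Cycles of a permutation \<open>p\<close> of \<open>S\<close>, each given by the set of its elements; fixed points in \<open>S\<close>
  count as cycles.
\<close>

definition perm_cycles :: "('h \<Rightarrow> 'h) \<Rightarrow> 'h set \<Rightarrow> 'h set set" where
  "perm_cycles p S = orbit p ` S"

definition cycle_type :: "('h \<Rightarrow> 'h) \<Rightarrow> 'h set \<Rightarrow> nat multiset" where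
  "cycle_type p S = image_mset card (mset_set (perm_cycles p S))"

text \<open>
  Here \<open>\<alpha>\<close> and the vertex of every half edge belong to the graph, so the embeddings of \<open>G\<close> differ in
  the cyclic orders of the half edges around the vertices only.
\<close>

definition embedding_of ::
    "('v, 'h) pre_digraph \<Rightarrow> ('h \<Rightarrow> 'h) \<Rightarrow> ('h \<Rightarrow> 'h) \<Rightarrow> ('h \<Rightarrow> 'h) \<Rightarrow> bool" where
  "embedding_of G \<alpha> \<beta> \<gamma> \<longleftrightarrow>
     \<beta> permutes arcs G \<and> (\<forall>v\<in>verts G. cyclic_on \<beta> (half_edges_at G v)) \<and> \<gamma> = \<alpha> \<circ> \<beta>"

text \<open>
  Vertices, edges and faces are the cycles of \<open>\<beta>\<close>, \<open>\<alpha>\<close> and \<open>\<gamma>\<close> on the set \<open>H\<close> of half edges. As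
  \<open>\<gamma> = \<alpha> \<circ> \<beta>\<close>, comparing signs shows that the Euler characteristic is even, so \<open>g\<close> exists.
\<close>

definition genus :: "'h set \<Rightarrow> ('h \<Rightarrow> 'h) \<Rightarrow> ('h \<Rightarrow> 'h) \<Rightarrow> ('h \<Rightarrow> 'h) \<Rightarrow> int" where
  "genus H \<alpha> \<beta> \<gamma> =
     (THE g. int (card (perm_cycles \<beta> H)) - int (card (perm_cycles \<alpha> H))
               + int (card (perm_cycles \<gamma> H)) = 2 - 2 * g)"

definition g_min :: "('v, 'h) pre_digraph \<Rightarrow> ('h \<Rightarrow> 'h) \<Rightarrow> int" where
  "g_min G \<alpha> = Min {genus (arcs G) \<alpha> \<beta> \<gamma> | \<beta> \<gamma>. embedding_of G \<alpha> \<beta> \<gamma>}"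

definition g_max :: "('v, 'h) pre_digraph \<Rightarrow> ('h \<Rightarrow> 'h) \<Rightarrow> int" where
  "g_max G \<alpha> = Max {genus (arcs G) \<alpha> \<beta> \<gamma> | \<beta> \<gamma>. embedding_of G \<alpha> \<beta> \<gamma>}"

definition incident_faces :: "('v, 'h) pre_digraph \<Rightarrow> ('h \<Rightarrow> 'h) \<Rightarrow> 'v \<Rightarrow> 'h set set" where
  "incident_faces G s v = {C \<in> perm_cycles s (arcs G). C \<inter> half_edges_at G v \<noteq> {}}"

text \<open>
  Deleting all elements outside \<open>S\<close> from the cycles of \<open>s\<close>: every \<open>x \<in> S\<close> is mapped to the next
  element of \<open>S\<close> following \<open>x\<close> on its cycle. As for \<open>perm_restrict\<close>, the result is the identity
  outside \<open>S\<close>.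
\<close>

definition perm_delete_outside :: "('h \<Rightarrow> 'h) \<Rightarrow> 'h set \<Rightarrow> 'h \<Rightarrow> 'h" where
  "perm_delete_outside s S x =
     (if x \<in> S then (s ^^ (LEAST n. 0 < n \<and> (s ^^ n) x \<in> S)) x else x)"

definition local_s :: "('v, 'h) pre_digraph \<Rightarrow> ('h \<Rightarrow> 'h) \<Rightarrow> 'v \<Rightarrow> 'h \<Rightarrow> 'h" where
  "local_s G s v = perm_delete_outside s (half_edges_at G v)"

definition local_pi :: "('v, 'h) pre_digraph \<Rightarrow> ('h \<Rightarrow> 'h) \<Rightarrow> 'v \<Rightarrow> 'h \<Rightarrow> 'h" where
  "local_pi G \<pi> v = perm_restrict \<pi> (half_edges_at G v)"

definition local_D :: "('v, 'h) pre_digraph \<Rightarrow> ('h \<Rightarrow> 'h) \<Rightarrow> ('h \<Rightarrow> 'h) \<Rightarrow> 'v \<Rightarrow> 'h \<Rightarrow> 'h" where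
  "local_D G s \<pi> v = local_s G s v \<circ> inv (local_pi G \<pi> v)"

definition T1 :: "('v, 'h) pre_digraph \<Rightarrow> ('h \<Rightarrow> 'h) \<Rightarrow> ('h \<Rightarrow> 'h) \<Rightarrow> int" where
  "T1 G s \<pi> =
     (MIN v\<in>verts G.
        - ((int (card (half_edges_at G v)) + 1
              - int (size (cycle_type (local_D G s \<pi> v) (half_edges_at G v)))
              - int (card (incident_faces G s v))) div 2))"

definition T2 :: "('v, 'h) pre_digraph \<Rightarrow> ('h \<Rightarrow> 'h) \<Rightarrow> int" where
  "T2 G s = (MAX v\<in>verts G. (int (card (incident_faces G s v)) - 1) div 2)"

end

theory Submission
  imports Defs
begin

text \<open>
  Both outer inequalities come from changing the rotation at one vertex \<open>v\<close> only. With
  \<open>S\<close> the set of half edges at \<open>v\<close>, such a change replaces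
  \<open>\<beta>\<close> by \<open>\<beta> \<circ> t\<close> for a permutation \<open>t\<close> of
  \<open>S\<close> for which \<open>\<beta> \<circ> t\<close> is still a single cycle on
  \<open>S\<close>. Because \<open>\<gamma> = \<alpha> \<circ> \<beta>\<close>, the faces become the
  cycles of \<open>\<gamma> \<circ> t\<close>: numbers of vertices and edges stay the same, and two
  more faces mean that the genus drops by one. So the question is how far the number of cycles of
  \<open>\<gamma> \<circ> t\<close> can be moved. The answer is read off from a product of
  transpositions, each of which merges two cycles or splits one
  (\<open>orbit_comp_transpose_merge\<close>, \<open>orbit_comp_transpose_split\<close>).

  Raising the genus. If three faces meet \<open>v\<close>, a suitably oriented 3-cycle on one half
  edge from each of them keeps the rotation a single cycle and joins the three faces into one
  (\<open>join_three_cycles\<close>). This can be repeated \<open>\<lfloor>(q - 1) /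
  2\<rfloor>\<close> times when \<open>q\<close> faces meet \<open>v\<close>.

  Lowering the genus. Let \<open>s\<close> be the face permutation induced on \<open>S\<close>, and
  \<open>D = s \<circ> inv pi\<close>. The permutation \<open>\<gamma> \<circ> inv s\<close> has the
  largest conceivable number of cycles, no two half edges at \<open>v\<close> sharing one, whereas
  \<open>\<beta> \<circ> inv s\<close> is the inverse of \<open>D\<close> on \<open>S\<close>, hence
  not a legitimate rotation in general. With \<open>\<ell>\<close> denoting the number of cycles of
  \<open>D\<close>, it is repaired by \<open>\<ell> - 1\<close> transpositions that merge the cycles
  of \<open>D\<close>; each of them also merges two faces (\<open>merge_all_cycles\<close>). At
  \<open>v\<close> there remain \<open>deg v - \<ell> + 1\<close> faces instead of \<open>q\<close>.

  The middle inequality only needs \<open>\<ell> \<le> deg v\<close>, once the numerator \<open>deg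
  v + 1 - \<ell> - q\<close> is known to be even; this holds because twice a difference of two
  genera equals it.
\<close>

section \<open>Multiplying a permutation by a transposition\<close>

lemma orbit_eq_iff:
  assumes "permutation p"
  shows "orbit p x = orbit p y \<longleftrightarrow> y \<in> orbit p x"
  using assms by (metis cyclic_on_orbit' orbit_cyclic_eq3 permutation_self_in_orbit)

lemma orbit_subset_closed:
  assumes "x \<in> A" and "\<And>a. a \<in> A \<Longrightarrow> p a \<in> A"
  shows "orbit p x \<subseteq> A"
proof
  fix y assume "y \<in> orbit p x"
  then show "y \<in> A" by induction (use assms in auto)
qed

lemma permutation_comp_transpose:
  "permutation p \<Longrightarrow> permutation (p \<circ> Transposition.transpose x y)"
  by (simp add: permutation_compose permutation_swap_id)

lemma comp_transpose_cancel:
  "p \<circ> Transposition.transpose x y \<circ> Transposition.transpose x y = p"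
  by (simp add: o_assoc [symmetric])

text \<open>
  Starting at \<open>y\<close>, the product jumps to \<open>p x\<close> and then follows
  \<open>p\<close> along the cycle of \<open>x\<close>. The jump back at \<open>y\<close> cannot
  interrupt this walk, because \<open>y\<close> is not on that cycle.
\<close>
lemma orbit_subset_comp_transpose:
  assumes "permutation p" and "y \<notin> orbit p x"
  shows "orbit p x \<subseteq> orbit (p \<circ> Transposition.transpose x y) y"
proof
  fix z assume "z \<in> orbit p x"
  then show "z \<in> orbit (p \<circ> Transposition.transpose x y) y"
  proof induction
    case base
    show ?case by (rule orbit_eqI(1)) simp
  next
    case (step z)
    show ?case
    proof (cases "z = x")
      case True
      show ?thesis by (rule orbit_eqI(1)) (simp add: True)
    next
      case False
      moreover have "z \<noteq> y" using step.hyps assms by auto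
      ultimately have "(p \<circ> Transposition.transpose x y) z = p z" by (simp add: transpose_def)
      then show ?thesis using orbit.step[OF step.IH] by simp
    qed
  qed
qed

text \<open>
  Each of \<open>x\<close> and \<open>y\<close> is entered at the point where the other cycle used
  to be left, so the two cycles are concatenated.
\<close>
lemma orbit_comp_transpose_merge:
  assumes p: "permutation p" and y: "y \<notin> orbit p x" and z: "z \<in> orbit p x \<union> orbit p y"
  shows "orbit (p \<circ> Transposition.transpose x y) z = orbit p x \<union> orbit p y"
proof -
  let ?q = "p \<circ> Transposition.transpose x y"
  have q: "permutation ?q" using p by (rule permutation_comp_transpose)
  have x: "x \<notin> orbit p y" using y p by (metis orbit_eq_iff permutation_self_in_orbit)
  have sub1: "orbit p x \<subseteq> orbit ?q y" using p y by (rule orbit_subset_comp_transpose)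
  have sub2: "orbit p y \<subseteq> orbit ?q x"
    using orbit_subset_comp_transpose[OF p x] by (simp add: transpose_commute)
  have eq: "orbit ?q x = orbit ?q y"
    using sub1 orbit_eq_iff[OF q] permutation_self_in_orbit[OF p] by blast
  have xy: "x \<in> orbit p x" "y \<in> orbit p y" using permutation_self_in_orbit[OF p] by auto
  have "orbit ?q z = orbit ?q x" using z sub1 sub2 eq orbit_eq_iff[OF q] by blast
  moreover have "orbit ?q x \<subseteq> orbit p x \<union> orbit p y"
  proof (rule orbit_subset_closed)
    fix a assume "a \<in> orbit p x \<union> orbit p y"
    then have "p a \<in> orbit p x \<union> orbit p y" by (blast intro: orbit.step)
    then show "?q a \<in> orbit p x \<union> orbit p y"
      using orbit.base[of p x] orbit.base[of p y] by (simp add: transpose_def)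
  qed (use xy in simp)
  ultimately show ?thesis using sub1 sub2 eq by blast
qed

lemma orbit_comp_permutes_disjoint:
  assumes "permutation p" and "t permutes S" and "orbit p z \<inter> S = {}"
  shows "orbit (p \<circ> t) z = orbit p z"
proof (rule orbit_cong)
  fix s assume "s \<in> orbit p z"
  then show "(p \<circ> t) s = p s" using assms by (metis comp_apply disjoint_iff permutes_not_in)
qed (rule permutation_self_in_orbit[OF assms(1)])

text \<open>
  The converse situation: if \<open>y = p\<^sup>k x\<close> with \<open>k > 0\<close> least, then
  the arc from \<open>p x\<close> to \<open>y\<close> is closed under the product and avoids
  \<open>x\<close>, because \<open>y\<close> is now sent to \<open>p x\<close>.
\<close>
lemma orbit_comp_transpose_split:
  assumes p: "permutation p" and y: "y \<in> orbit p x" and "x \<noteq> y"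
  shows "y \<notin> orbit (p \<circ> Transposition.transpose x y) x"
proof -
  let ?q = "p \<circ> Transposition.transpose x y"
  have q: "permutation ?q" using p by (rule permutation_comp_transpose)
  let ?P = "\<lambda>k. 0 < k \<and> (p ^^ k) x = y"
  define k where "k = (LEAST k. ?P k)"
  have "\<exists>k. ?P k" using y by (auto simp: orbit_altdef)
  then have k: "0 < k" "(p ^^ k) x = y" unfolding k_def by (metis (mono_tags, lifting) LeastI)+
  have least: "(p ^^ j) x \<noteq> y" if "0 < j" "j < k" for j
    using that not_less_Least[of j ?P] unfolding k_def by auto
  have no_return: "(p ^^ j) x \<noteq> x" if "0 < j" "j \<le> k" for j
  proof
    assume j: "(p ^^ j) x = x"
    with k \<open>x \<noteq> y\<close> have "j \<noteq> k" by auto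
    with that have "j < k" by simp
    have "(p ^^ k) x = (p ^^ (k - j)) ((p ^^ j) x)"
      using that by (metis comp_apply funpow_add le_add_diff_inverse2)
    with j k have "(p ^^ (k - j)) x = y" by simp
    then show False using least[of "k - j"] that \<open>j < k\<close> by simp
  qed
  let ?A = "(\<lambda>j. (p ^^ j) x) ` {1..k}"
  have "orbit ?q y \<subseteq> ?A"
  proof (rule orbit_subset_closed)
    show "y \<in> ?A" using k by force
    fix a assume "a \<in> ?A"
    then obtain j where j: "1 \<le> j" "j \<le> k" "a = (p ^^ j) x" by auto
    show "?q a \<in> ?A"
    proof (cases "j = k")
      case True
      then have "?q a = (p ^^ 1) x" using j k by simp
      then show ?thesis using k by (metis One_nat_def Suc_leI atLeastAtMost_iff imageI order_refl)
    next
      case False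
      then have "a \<noteq> x" "a \<noteq> y" using j least no_return by auto
      then have "?q a = (p ^^ Suc j) x" using j by (simp add: transpose_def)
      moreover have "Suc j \<in> {1..k}" using j False by simp
      ultimately show ?thesis by blast
    qed
  qed
  moreover have "x \<notin> ?A"
  proof
    assume "x \<in> ?A"
    then obtain j where "j \<in> {1..k}" "x = (p ^^ j) x" by (rule imageE)
    then show False using no_return[of j] by (metis Suc_le_eq One_nat_def atLeastAtMost_iff)
  qed
  ultimately have "x \<notin> orbit ?q y" by blast
  then show ?thesis using q by (metis orbit_eq_iff permutation_self_in_orbit)
qed

section \<open>Counting cycles\<close>

lemma finite_perm_cycles: "finite H \<Longrightarrow> finite (perm_cycles p H)"
  by (simp add: perm_cycles_def)

lemma orbit_comp_transpose_other:
  assumes p: "permutation p" and z: "z \<notin> orbit p x" "z \<notin> orbit p y"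
  shows "orbit (p \<circ> Transposition.transpose x y) z = orbit p z"
proof (rule orbit_comp_permutes_disjoint[OF p])
  show "Transposition.transpose x y permutes {x, y}" by (rule permutes_swap_id) auto
  show "orbit p z \<inter> {x, y} = {}"
    using z orbit_eq_iff[OF p] permutation_self_in_orbit[OF p] by blast
qed

text \<open>
  Merging only coarsens the partition into cycles. This keeps the refinement hypothesis of
  \<open>merge_all_cycles\<close> below stable under its induction.
\<close>
lemma orbit_subset_orbit_comp_transpose:
  assumes p: "permutation p" and y: "y \<notin> orbit p x"
  shows "orbit p z \<subseteq> orbit (p \<circ> Transposition.transpose x y) z"
proof (cases "z \<in> orbit p x \<union> orbit p y")
  case True
  then show ?thesis
    using orbit_comp_transpose_merge[OF p y True] orbit_eq_iff[OF p] by blast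
next
  case False
  then show ?thesis using orbit_comp_transpose_other[OF p] by simp
qed

lemma perm_cycles_comp_transpose_merge:
  assumes p: "permutation p" and H: "x \<in> H" "y \<in> H" and y: "y \<notin> orbit p x"
  shows "perm_cycles (p \<circ> Transposition.transpose x y) H =
           insert (orbit p x \<union> orbit p y) (perm_cycles p H - {orbit p x, orbit p y})"
    (is "?L = insert ?U ?R")
proof -
  let ?q = "p \<circ> Transposition.transpose x y"
  have merged: "orbit ?q z = ?U" if "z \<in> ?U" for z
    using orbit_comp_transpose_merge[OF p y that] .
  have kept: "orbit ?q z = orbit p z" if "z \<notin> ?U" for z
    using orbit_comp_transpose_other[OF p] that by blast
  have R: "orbit p z \<in> ?R \<longleftrightarrow> z \<notin> ?U" if "z \<in> H" for z
    using that orbit_eq_iff[OF p] unfolding perm_cycles_def by blast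
  have "x \<in> ?U" using permutation_self_in_orbit[OF p] by blast
  show ?thesis
  proof (intro equalityI subsetI)
    fix C assume "C \<in> ?L"
    then obtain z where z: "z \<in> H" "C = orbit ?q z" by (auto simp: perm_cycles_def)
    show "C \<in> insert ?U ?R"
      by (cases "z \<in> ?U") (use z merged kept[of z] R[of z] in simp_all)
  next
    fix C assume C: "C \<in> insert ?U ?R"
    show "C \<in> ?L"
    proof (cases "C = ?U")
      case True
      then show ?thesis using merged[OF \<open>x \<in> ?U\<close>] H by (auto simp: perm_cycles_def)
    next
      case False
      with C obtain z where z: "z \<in> H" "C = orbit p z" by (auto simp: perm_cycles_def)
      with C False R kept show ?thesis by (metis image_eqI insertE perm_cycles_def)
    qed
  qed
qed

lemma card_perm_cycles_comp_transpose_merge: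
  assumes "finite H" and p: "permutation p" and "x \<in> H" "y \<in> H" and y: "y \<notin> orbit p x"
  shows "Suc (card (perm_cycles (p \<circ> Transposition.transpose x y) H)) = card (perm_cycles p H)"
proof -
  let ?C = "perm_cycles p H" and ?U = "orbit p x \<union> orbit p y"
  have x: "x \<in> orbit p x" and y': "y \<in> orbit p y" using permutation_self_in_orbit[OF p] by auto
  have "orbit p x \<noteq> orbit p y" using y y' by auto
  moreover have sub: "{orbit p x, orbit p y} \<subseteq> ?C" using assms by (auto simp: perm_cycles_def)
  moreover have "?U \<notin> ?C"
  proof
    assume "?U \<in> ?C"
    then obtain z where "?U = orbit p z" by (auto simp: perm_cycles_def)
    then have "orbit p z = orbit p x" using orbit_eq_iff[OF p] x by blast
    then show False using y y' \<open>?U = orbit p z\<close> by blast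
  qed
  moreover have "finite ?C" using assms by (simp add: finite_perm_cycles)
  ultimately have "card (insert ?U (?C - {orbit p x, orbit p y})) = Suc (card ?C - 2)"
     "2 \<le> card ?C"
    using card_mono[OF _ sub] by (auto simp: card_Diff_subset)
  then show ?thesis using perm_cycles_comp_transpose_merge[OF assms(2-)] by simp
qed

text \<open>
  A permutation of \<open>S\<close> is invisible to the cycles that miss \<open>S\<close>. The
  reverse inclusion is the forward one applied to \<open>p \<circ> t\<close> and the inverse of
  \<open>t\<close>.
\<close>
lemma perm_cycles_comp_permutes_disjoint:
  assumes p: "permutation p" and t: "t permutes S" and "finite S"
  shows "{C \<in> perm_cycles (p \<circ> t) H. C \<inter> S = {}} = {C \<in> perm_cycles p H. C \<inter> S = {}}"
proof -
  have sub: "{C \<in> perm_cycles p H. C \<inter> S = {}} \<subseteq> {C \<in> perm_cycles (p \<circ> t) H. C \<inter> S = {}}"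
    if "permutation p" "t permutes S" for p t
    using that orbit_comp_permutes_disjoint[of p t S] by (auto simp: perm_cycles_def)
  have "permutation t" using t \<open>finite S\<close> by (auto simp: permutation_permutes)
  then have pt: "permutation (p \<circ> t)" using p by (simp add: permutation_compose)
  have "p \<circ> t \<circ> inv t = p" using permutes_inv_o(1)[OF t] by (simp add: o_assoc[symmetric])
  then show ?thesis using sub[OF p t] sub[OF pt permutes_inv[OF t]] by auto
qed

lemma card_perm_cycles_split_incident:
  assumes "finite H"
  shows "card (perm_cycles p H) = card {C \<in> perm_cycles p H. C \<inter> S \<noteq> {}}
            + card {C \<in> perm_cycles p H. C \<inter> S = {}}"
proof -
  have "perm_cycles p H = {C \<in> perm_cycles p H. C \<inter> S \<noteq> {}} \<union> {C \<in> perm_cycles p H. C \<inter> S = {}}"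
    by blast
  then show ?thesis
    using card_Un_disjoint[of "{C \<in> perm_cycles p H. C \<inter> S \<noteq> {}}" "{C \<in> perm_cycles p H. C \<inter> S = {}}"]
      finite_perm_cycles[OF assms, of p] by auto
qed

text \<open>
  Every transposition changes the number of cycles by exactly one, up or down according to whether
  it splits or merges.
\<close>
lemma evenperm_iff_perm_cycles:
  assumes fin: "finite H" and "p permutes H"
  shows "evenperm p \<longleftrightarrow> even (card H + card (perm_cycles p H))"
  using assms
proof (induction rule: permutes_rev_induct)
  case id
  have "perm_cycles id H = (\<lambda>x. {x}) ` H"
    unfolding perm_cycles_def by (rule image_cong) (simp_all add: orbit_eq_singleton_iff)
  then have "card (perm_cycles id H) = card H" by (simp add: card_image)
  then have "even (card H + card (perm_cycles id H))" by (simp only:) simp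
  then show ?case by (simp only: evenperm_id)
next
  case (swap x y p)
  let ?q = "p \<circ> Transposition.transpose x y"
  have pp: "permutation p" using swap fin by (auto simp: permutation_permutes)
  have qq: "permutation ?q" using pp by (rule permutation_comp_transpose)
  have "evenperm ?q \<longleftrightarrow> \<not> evenperm p"
    using swap pp by (simp add: evenperm_comp permutation_swap_id evenperm_swap)
  moreover have "Suc (card (perm_cycles ?q H)) = card (perm_cycles p H)
       \<or> Suc (card (perm_cycles p H)) = card (perm_cycles ?q H)"
  proof (cases "y \<in> orbit p x")
    case True
    have "y \<notin> orbit ?q x" using orbit_comp_transpose_split[OF pp True] swap by blast
    then show ?thesis
      using card_perm_cycles_comp_transpose_merge[OF fin qq, of x y] swap
      by (simp add: comp_transpose_cancel)
  next
    case False
    then show ?thesis using card_perm_cycles_comp_transpose_merge[OF fin pp] swap by blast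
  qed
  moreover have "even (card H + a) \<longleftrightarrow> \<not> even (card H + b)" if "Suc a = b \<or> Suc b = a" for a b
    using that by auto
  ultimately show ?case using swap.IH by blast
qed

lemma cyclic_on_comp_transpose_merge:
  assumes "permutation p" and "S = orbit p x \<union> orbit p y" and "y \<notin> orbit p x"
  shows "cyclic_on (p \<circ> Transposition.transpose x y) S"
proof -
  have "x \<in> S" using assms permutation_self_in_orbit[of p] by blast
  then show ?thesis
    using assms orbit_comp_transpose_merge[of p y x x] by (metis cyclic_on_def)
qed

section \<open>Joining cycles while controlling a second permutation\<close>

text \<open>
  Of the two orientations of a 3-cycle on three points of a long cycle, one preserves the long
  cycle. In terms of transpositions: \<open>(x y)\<close> cuts the cycle into one part containing
  \<open>x\<close> and one containing \<open>y\<close>; the point \<open>z\<close> lies in one of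
  them, and \<open>w\<close> is chosen in the other, so that \<open>(w z)\<close> joins the parts
  again. For \<open>z\<close> equal to \<open>x\<close> or \<open>y\<close> the product degenerates
  but the claim remains.
\<close>
lemma cyclic_on_comp_three_cycle:
  assumes c: "permutation c" and cyc: "cyclic_on c S" and S: "x \<in> S" "y \<in> S" "z \<in> S" and "x \<noteq> y"
  obtains w where "w \<in> {x, y}"
    "cyclic_on (c \<circ> Transposition.transpose x y \<circ> Transposition.transpose w z) S"
proof -
  let ?c = "c \<circ> Transposition.transpose x y"
  have c': "permutation ?c" using c by (rule permutation_comp_transpose)
  have "y \<in> orbit c x" using orbit_cyclic_eq3[OF cyc \<open>x \<in> S\<close>] S by simp
  then have split: "y \<notin> orbit ?c x" using orbit_comp_transpose_split[OF c] \<open>x \<noteq> y\<close> by blast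
  have union: "S = orbit ?c x \<union> orbit ?c y"
    using orbit_comp_transpose_merge[OF c' split, of x] permutation_self_in_orbit[OF c']
      orbit_cyclic_eq3[OF cyc \<open>x \<in> S\<close>]
    by (simp add: comp_transpose_cancel)
  show thesis
  proof (cases "z \<in> orbit ?c x")
    case True
    then have eq: "orbit ?c z = orbit ?c x" using orbit_eq_iff[OF c'] by blast
    then have "z \<notin> orbit ?c y"
      using split orbit_eq_iff[OF c'] permutation_self_in_orbit[OF c'] by blast
    then show thesis using that[of y] cyclic_on_comp_transpose_merge[OF c', of S y z] union eq by blast
  next
    case False
    then have "orbit ?c z = orbit ?c y" using orbit_eq_iff[OF c'] union S by blast
    then show thesis using that[of x] cyclic_on_comp_transpose_merge[OF c', of S x z] union False by blast
  qed
qed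

text \<open>
  With \<open>b\<close> the rotation and \<open>c\<close> the face permutation, and \<open>S\<close>
  the half edges at a vertex: if three faces meet the vertex, one point from each gives a 3-cycle
  that keeps the rotation cyclic. It joins the three faces into one, since both of its
  transpositions merge, whichever \<open>w\<close> was chosen: after the first one, \<open>x\<close>
  and \<open>y\<close> lie in the same cycle.
\<close>
lemma join_three_cycles:
  assumes fin: "finite H" and "S \<subseteq> H" and b: "permutation b" and c: "permutation c"
    and cyc: "cyclic_on b S" and three: "3 \<le> card {C \<in> perm_cycles c H. C \<inter> S \<noteq> {}}"
  obtains t where "t permutes S" "cyclic_on (b \<circ> t) S"
    "card (perm_cycles (c \<circ> t) H) + 2 = card (perm_cycles c H)"
proof -
  obtain T where T: "T \<subseteq> {C \<in> perm_cycles c H. C \<inter> S \<noteq> {}}" "card T = 3"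
    using obtain_subset_with_card_n[OF three] by blast
  obtain X Y Z where XYZ: "T = {X, Y, Z}" "X \<noteq> Y" "Y \<noteq> Z" "X \<noteq> Z"
    using T(2) by (auto simp: card_3_iff)
  have orb: "C = orbit c u" if u: "u \<in> C" and C: "C \<in> T" for u C
  proof -
    obtain a where "C = orbit c a" using C T(1) by (auto simp: perm_cycles_def)
    then show ?thesis using u orbit_eq_iff[OF c] by blast
  qed
  obtain x y z where xyz: "x \<in> X" "y \<in> Y" "z \<in> Z" and S: "x \<in> S" "y \<in> S" "z \<in> S"
  proof -
    have "X \<inter> S \<noteq> {}" "Y \<inter> S \<noteq> {}" "Z \<inter> S \<noteq> {}" using T(1) unfolding XYZ(1) by simp_all
    then show ?thesis using that by blast
  qed
  have X: "X = orbit c x" "Y = orbit c y" "Z = orbit c z"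
    using orb xyz XYZ(1) by simp_all
  have ne: "y \<notin> orbit c x" "z \<notin> orbit c x" "z \<notin> orbit c y"
    using XYZ(2-4) unfolding X by (simp_all add: orbit_eq_iff[OF c])
  have "x \<noteq> y" using ne permutation_self_in_orbit[OF c] by blast
  then obtain w where w: "w \<in> {x, y}"
    and cyc': "cyclic_on (b \<circ> Transposition.transpose x y \<circ> Transposition.transpose w z) S"
    using cyclic_on_comp_three_cycle[OF b cyc S] by blast
  let ?c = "c \<circ> Transposition.transpose x y"
  have c': "permutation ?c" using c by (rule permutation_comp_transpose)
  have "w \<in> orbit c x \<union> orbit c y" using w permutation_self_in_orbit[OF c] by blast
  then have z: "z \<notin> orbit ?c w" using orbit_comp_transpose_merge[OF c ne(1)] ne by simp
  have H: "x \<in> H" "y \<in> H" "z \<in> H" "w \<in> H" using S w \<open>S \<subseteq> H\<close> by auto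
  let ?t = "Transposition.transpose x y \<circ> Transposition.transpose w z"
  show thesis
  proof (rule that[of ?t])
    show "?t permutes S" by (intro permutes_compose permutes_swap_id) (use S w in auto)
    show "cyclic_on (b \<circ> ?t) S" using cyc' by (simp add: o_assoc)
    show "card (perm_cycles (c \<circ> ?t) H) + 2 = card (perm_cycles c H)"
      using card_perm_cycles_comp_transpose_merge[OF fin c H(1,2) ne(1)]
        card_perm_cycles_comp_transpose_merge[OF fin c' H(4,3) z]
      by (simp add: o_assoc)
  qed
qed

text \<open>
  Iteration of the previous step until at most two cycles meet \<open>S\<close>. Cycles missing
  \<open>S\<close> never change, so the number of cycles meeting \<open>S\<close> drops by the same
  amount as the total.
\<close>
lemma join_cycles_in_pairs:
  assumes fin: "finite H" and sub: "S \<subseteq> H" and "permutation b" and "permutation c" and "cyclic_on b S"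
  shows "\<exists>t. t permutes S \<and> cyclic_on (b \<circ> t) S \<and>
    card (perm_cycles (c \<circ> t) H) + 2 * ((card {C \<in> perm_cycles c H. C \<inter> S \<noteq> {}} - 1) div 2)
      = card (perm_cycles c H)"
  using assms(3-)
proof (induction "card {C \<in> perm_cycles c H. C \<inter> S \<noteq> {}}" arbitrary: b c rule: less_induct)
  case (less c b)
  let ?q = "\<lambda>c. card {C \<in> perm_cycles c H. C \<inter> S \<noteq> {}}"
  have finS: "finite S" using fin sub by (rule rev_finite_subset)
  show ?case
  proof (cases "3 \<le> ?q c")
    case False
    then have "(?q c - 1) div 2 = 0" by auto
    then show ?thesis using less.prems by (intro exI[of _ id]) (auto simp: permutes_id)
  next
    case True
    obtain t where t: "t permutes S" "cyclic_on (b \<circ> t) S"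
      "card (perm_cycles (c \<circ> t) H) + 2 = card (perm_cycles c H)"
      using join_three_cycles[OF fin sub less.prems True] .
    have pt: "permutation t" using t(1) finS by (auto simp: permutation_permutes)
    have q: "?q (c \<circ> t) + 2 = ?q c"
      using t(3) card_perm_cycles_split_incident[OF fin, of c S]
        card_perm_cycles_split_incident[OF fin, of "c \<circ> t" S]
        perm_cycles_comp_permutes_disjoint[OF less.prems(2) t(1) finS, of H]
      by simp
    obtain u where u: "u permutes S" "cyclic_on (b \<circ> t \<circ> u) S"
      "card (perm_cycles (c \<circ> t \<circ> u) H) + 2 * ((?q (c \<circ> t) - 1) div 2)
         = card (perm_cycles (c \<circ> t) H)"
      using less.hyps[of "c \<circ> t" "b \<circ> t"] q t less.prems pt by (auto simp: permutation_compose)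
    have "(?q c - 1) div 2 = Suc ((?q (c \<circ> t) - 1) div 2)" using q True by linarith
    then have "card (perm_cycles (c \<circ> (t \<circ> u)) H) + 2 * ((?q c - 1) div 2)
         = card (perm_cycles c H)" using u(3) t(3) by (simp add: o_assoc)
    moreover have "t \<circ> u permutes S" using u t by (intro permutes_compose)
    ultimately show ?thesis using u(2) by (intro exI[of _ "t \<circ> u"]) (simp add: o_assoc)
  qed
qed

text \<open>
  If the cycles of \<open>c\<close> separate points of \<open>S\<close> at least as well as those of
  \<open>b\<close>, then a transposition that merges two cycles of \<open>b\<close> also merges two
  cycles of \<open>c\<close>, and the separation hypothesis survives. Hence making \<open>b\<close>
  a single cycle on \<open>S\<close> costs \<open>c\<close> exactly one cycle less than
  \<open>b\<close> has on \<open>S\<close>.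
\<close>
lemma merge_all_cycles:
  assumes fin: "finite H" and sub: "S \<subseteq> H" and ne: "S \<noteq> {}"
    and "permutation b" and "permutation c"
    and "\<And>x. x \<in> S \<Longrightarrow> b x \<in> S"
    and "\<And>x y. x \<in> S \<Longrightarrow> y \<in> S \<Longrightarrow> y \<in> orbit c x \<Longrightarrow> y \<in> orbit b x"
  shows "\<exists>t. t permutes S \<and> cyclic_on (b \<circ> t) S \<and>
    card (perm_cycles (c \<circ> t) H) + card (perm_cycles b S) = card (perm_cycles c H) + 1"
  using assms(4-)
proof (induction "card (perm_cycles b S)" arbitrary: b c rule: less_induct)
  case (less b c)
  note b = less.prems(1) and c = less.prems(2) and closed = less.prems(3) and finer = less.prems(4)
  have finS: "finite S" using fin sub by (rule rev_finite_subset)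
  show ?case
  proof (cases "\<forall>x\<in>S. S \<subseteq> orbit b x")
    case True
    then have orb: "orbit b x = S" if "x \<in> S" for x
      using that orbit_subset_closed[of x S b] closed by blast
    then have "perm_cycles b S = {S}" using ne unfolding perm_cycles_def by auto
    moreover have "cyclic_on b S" using orb ne by (auto simp: cyclic_on_def)
    ultimately show ?thesis by (intro exI[of _ id]) (auto simp: permutes_id)
  next
    case False
    then obtain x y where xy: "x \<in> S" "y \<in> S" "y \<notin> orbit b x" by blast
    then have y: "y \<notin> orbit c x" using finer by blast
    let ?t = "Transposition.transpose x y"
    have pt: "?t permutes S" using xy by (intro permutes_swap_id)
    have b': "permutation (b \<circ> ?t)" and c': "permutation (c \<circ> ?t)"
      using b c by (auto intro: permutation_comp_transpose)
    have closed': "(b \<circ> ?t) u \<in> S" if "u \<in> S" for u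
      using closed that permutes_in_image[OF pt] by auto
    have finer': "v \<in> orbit (b \<circ> ?t) u" if uv: "u \<in> S" "v \<in> S" "v \<in> orbit (c \<circ> ?t) u" for u v
    proof (cases "u \<in> orbit c x \<union> orbit c y")
      case True
      then have "v \<in> orbit c x \<union> orbit c y" using uv orbit_comp_transpose_merge[OF c y] by blast
      with True have "u \<in> orbit b x \<union> orbit b y" "v \<in> orbit b x \<union> orbit b y"
        using finer uv xy by blast+
      then show ?thesis using orbit_comp_transpose_merge[OF b xy(3)] by blast
    next
      case False
      then have "v \<in> orbit c u" using uv orbit_comp_transpose_other[OF c] by blast
      then show ?thesis using finer uv orbit_subset_orbit_comp_transpose[OF b xy(3)] by blast
    qed
    have cb: "Suc (card (perm_cycles (b \<circ> ?t) S)) = card (perm_cycles b S)"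
      using card_perm_cycles_comp_transpose_merge[OF finS b xy] .
    have cc: "Suc (card (perm_cycles (c \<circ> ?t) H)) = card (perm_cycles c H)"
      using card_perm_cycles_comp_transpose_merge[OF fin c _ _ y] xy sub by blast
    have "card (perm_cycles (b \<circ> ?t) S) < card (perm_cycles b S)" using cb by simp
    from less.hyps[OF this b' c' closed' finer'] obtain u where
      u: "u permutes S" "cyclic_on (b \<circ> ?t \<circ> u) S"
        "card (perm_cycles (c \<circ> ?t \<circ> u) H) + card (perm_cycles (b \<circ> ?t) S)
          = card (perm_cycles (c \<circ> ?t) H) + 1" by blast
    have "?t \<circ> u permutes S" using u pt by (intro permutes_compose)
    then show ?thesis using u(2,3) cb cc by (intro exI[of _ "?t \<circ> u"]) (simp add: o_assoc)
  qed
qed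

section \<open>First-return permutations\<close>

lemma perm_delete_outside_return:
  assumes "permutation p" and "x \<in> S"
  obtains n where "0 < n" "perm_delete_outside p S x = (p ^^ n) x" "(p ^^ n) x \<in> S"
    "\<And>j. 0 < j \<Longrightarrow> j < n \<Longrightarrow> (p ^^ j) x \<notin> S"
proof -
  let ?P = "\<lambda>n. 0 < n \<and> (p ^^ n) x \<in> S"
  have "\<exists>n. ?P n" using permutation_self[OF assms(1), of x] assms(2) by metis
  then have "?P (LEAST n. ?P n)" by (rule LeastI_ex)
  moreover have "(p ^^ j) x \<notin> S" if "0 < j" "j < (LEAST n. ?P n)" for j
    using that not_less_Least[of j ?P] by blast
  ultimately show thesis using that[of "LEAST n. ?P n"] assms(2)
    by (simp add: perm_delete_outside_def)
qed

text \<open>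
  Injectivity: if two points of \<open>S\<close> first return to \<open>S\<close> at the same place
  after \<open>m \<le> n\<close> steps, then cancelling \<open>m\<close> steps puts the former on
  the path of the latter after \<open>n - m\<close> steps, which is before its first return unless
  \<open>m = n\<close>.
\<close>
lemma perm_delete_outside_permutes:
  assumes p: "permutation p" and "finite S"
  shows "perm_delete_outside p S permutes S"
proof -
  let ?s = "perm_delete_outside p S"
  have into: "?s ` S \<subseteq> S" using perm_delete_outside_return[OF p] by (metis image_subsetI)
  have "inj_on ?s S"
  proof (rule inj_onI)
    have *: "m = n \<and> x = y"
      if "m \<le> n" "(p ^^ m) x = (p ^^ n) y" "x \<in> S" "0 < m" "\<And>j. 0 < j \<Longrightarrow> j < n \<Longrightarrow> (p ^^ j) y \<notin> S"
      for m n x y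
    proof -
      have "inj (p ^^ m)" using p by (simp add: bij_is_inj bij_fn permutation_bijective)
      moreover have "(p ^^ m) x = (p ^^ m) ((p ^^ (n - m)) y)"
        using that(1,2) by (metis comp_apply funpow_add le_add_diff_inverse)
      ultimately have x: "x = (p ^^ (n - m)) y" by (simp add: inj_eq)
      have "m = n"
      proof (rule ccontr)
        assume "m \<noteq> n"
        then show False using that(1,3,4) that(5)[of "n - m"] x by auto
      qed
      then show ?thesis using x by simp
    qed
    fix x y assume xy: "x \<in> S" "y \<in> S" "?s x = ?s y"
    obtain m where m: "0 < m" "?s x = (p ^^ m) x" "\<And>j. 0 < j \<Longrightarrow> j < m \<Longrightarrow> (p ^^ j) x \<notin> S"
      using perm_delete_outside_return[OF p xy(1)] by metis
    obtain n where n: "0 < n" "?s y = (p ^^ n) y" "\<And>j. 0 < j \<Longrightarrow> j < n \<Longrightarrow> (p ^^ j) y \<notin> S"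
      using perm_delete_outside_return[OF p xy(2)] by metis
    have eq: "(p ^^ m) x = (p ^^ n) y" using m n xy by simp
    show "x = y"
    proof (cases "m \<le> n")
      case True
      then show ?thesis using *[of m n x y] eq m n xy by blast
    next
      case False
      then show ?thesis using *[of n m y x] eq m n xy by simp
    qed
  qed
  then have "bij_betw ?s S S" using endo_inj_surj[OF \<open>finite S\<close> into] by (simp add: bij_betw_def)
  then show ?thesis by (rule bij_imp_permutes) (simp add: perm_delete_outside_def)
qed

text \<open>
  Let \<open>s\<close> be the first-return map and \<open>w\<close> the point of \<open>S\<close>
  that returns at \<open>x\<close>. From \<open>x\<close>, the product goes back to \<open>w\<close>
  and forward to \<open>p w\<close>; outside \<open>S\<close> it agrees with \<open>p\<close>, so it
  follows the path of \<open>w\<close> until the first return, which is \<open>x\<close>. Every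
  cycle of \<open>p\<close> is thereby cut into its excursions between visits to \<open>S\<close>.
\<close>
lemma orbit_comp_inv_perm_delete_outside:
  assumes p: "permutation p" and fin: "finite S" and x: "x \<in> S"
  shows "orbit (p \<circ> inv (perm_delete_outside p S)) x \<inter> S = {x}"
proof -
  let ?s = "perm_delete_outside p S"
  let ?c = "p \<circ> inv ?s"
  have s: "?s permutes S" using p fin by (rule perm_delete_outside_permutes)
  have si: "inv ?s permutes S" using s by (rule permutes_inv)
  define w where "w = inv ?s x"
  have w: "w \<in> S" "?s w = x"
    using x permutes_in_image[OF si] permutes_inverses(1)[OF s] by (auto simp: w_def)
  obtain n where n: "0 < n" "(p ^^ n) w = x" "\<And>j. 0 < j \<Longrightarrow> j < n \<Longrightarrow> (p ^^ j) w \<notin> S"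
    using perm_delete_outside_return[OF p w(1)] w(2) by metis
  let ?A = "(\<lambda>j. (p ^^ j) w) ` {1..n}"
  have "orbit ?c x \<subseteq> ?A"
  proof (rule orbit_subset_closed)
    show "x \<in> ?A" using n by (intro image_eqI[of _ _ n]) auto
    fix a assume "a \<in> ?A"
    then obtain j where j: "1 \<le> j" "j \<le> n" "a = (p ^^ j) w" by auto
    show "?c a \<in> ?A"
    proof (cases "j = n")
      case True
      then have "?c a = (p ^^ 1) w" using j n by (simp add: w_def)
      then show ?thesis using n by (intro image_eqI[of _ _ 1]) auto
    next
      case False
      then have "a \<notin> S" using j n(3) by simp
      then have "?c a = (p ^^ Suc j) w" using j permutes_not_in[OF si] by simp
      moreover have "Suc j \<in> {1..n}" using j False by simp
      ultimately show ?thesis by (rule image_eqI)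
    qed
  qed
  moreover have "?A \<inter> S \<subseteq> {x}"
  proof
    fix a assume "a \<in> ?A \<inter> S"
    then obtain j where j: "1 \<le> j" "j \<le> n" "a = (p ^^ j) w" "a \<in> S" by auto
    then have "j = n" using n(3)[of j] by (cases "j = n") auto
    then show "a \<in> {x}" using j n by simp
  qed
  moreover have "permutation ?c"
    using permutation_compose[OF p permutes_imp_permutation[OF fin si]] .
  ultimately show ?thesis using x permutation_self_in_orbit[of ?c x] by blast
qed

text \<open>
  By the previous lemma, the cycles of the product that meet \<open>S\<close> correspond to the
  elements of \<open>S\<close>; those that miss \<open>S\<close> are unchanged.
\<close>
lemma card_perm_cycles_comp_inv_perm_delete_outside:
  assumes finH: "finite H" and sub: "S \<subseteq> H" and p: "permutation p"
  shows "card (perm_cycles (p \<circ> inv (perm_delete_outside p S)) H)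
           + card {C \<in> perm_cycles p H. C \<inter> S \<noteq> {}} = card (perm_cycles p H) + card S"
proof -
  let ?s = "perm_delete_outside p S"
  let ?c = "p \<circ> inv ?s"
  have fin: "finite S" using finH sub by (rule rev_finite_subset)
  have si: "inv ?s permutes S" using perm_delete_outside_permutes[OF p fin] by (rule permutes_inv)
  have pc: "permutation ?c"
    using permutation_compose[OF p permutes_imp_permutation[OF fin si]] .
  note meet = orbit_comp_inv_perm_delete_outside[OF p fin]
  have "{C \<in> perm_cycles ?c H. C \<inter> S \<noteq> {}} = orbit ?c ` S" (is "?L = ?R")
  proof (intro equalityI subsetI)
    fix C assume "C \<in> ?L"
    then obtain a x where "C = orbit ?c a" "x \<in> C" "x \<in> S" by (auto simp: perm_cycles_def)
    then have "C = orbit ?c x" using orbit_eq_iff[OF pc] by blast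
    then show "C \<in> ?R" using \<open>x \<in> S\<close> by blast
  next
    fix C assume "C \<in> ?R"
    then obtain x where "x \<in> S" "C = orbit ?c x" by blast
    then show "C \<in> ?L" using meet[of x] sub unfolding perm_cycles_def by blast
  qed
  moreover have "inj_on (orbit ?c) S"
  proof (rule inj_onI)
    fix x y assume "x \<in> S" "y \<in> S" "orbit ?c x = orbit ?c y"
    then have "{x} = {y}" using meet by metis
    then show "x = y" by simp
  qed
  ultimately have "card {C \<in> perm_cycles ?c H. C \<inter> S \<noteq> {}} = card S" by (simp add: card_image)
  then show ?thesis
    using card_perm_cycles_split_incident[OF finH, of p S]
      card_perm_cycles_split_incident[OF finH, of ?c S]
      perm_cycles_comp_permutes_disjoint[OF p si fin, of H]
    by simp
qed

section \<open>Embeddings and the Euler characteristic\<close>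

lemma finite_connected_graph_arcs:
  assumes "finite_connected_graph G \<alpha>"
  shows "finite (arcs G)" "finite (verts G)" "verts G \<noteq> {}" "\<alpha> permutes arcs G"
    "\<And>h. h \<in> arcs G \<Longrightarrow> \<alpha> h \<noteq> h" "\<alpha> \<circ> \<alpha> = id" "\<And>h. h \<in> arcs G \<Longrightarrow> tail G h \<in> verts G"
proof -
  interpret fin_digraph G using assms by (simp add: finite_connected_graph_def)
  interpret bidirected_digraph G \<alpha> using assms by (simp add: finite_connected_graph_def)
  show "finite (arcs G)" "finite (verts G)" "\<alpha> permutes arcs G"
    "\<And>h. h \<in> arcs G \<Longrightarrow> \<alpha> h \<noteq> h" "\<alpha> \<circ> \<alpha> = id" "\<And>h. h \<in> arcs G \<Longrightarrow> tail G h \<in> verts G"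
    by (auto simp: arev_permutes_arcs arev_dom)
  show "verts G \<noteq> {}"
  proof -
    obtain h where "h \<in> arcs G" using assms by (auto simp: finite_connected_graph_def)
    then show ?thesis using tail_in_verts[of h] by blast
  qed
qed

lemma embedding_permutes:
  assumes "finite_connected_graph G \<alpha>" and "embedding_of G \<alpha> \<beta> \<gamma>"
  shows "\<beta> permutes arcs G" "\<gamma> permutes arcs G" "permutation \<beta>" "permutation \<gamma>"
proof -
  show b: "\<beta> permutes arcs G" using assms by (simp add: embedding_of_def)
  show c: "\<gamma> permutes arcs G"
    using assms b finite_connected_graph_arcs(4)[OF assms(1)]
    by (auto simp: embedding_of_def intro: permutes_compose)
  show "permutation \<beta>" "permutation \<gamma>"
    using b c finite_connected_graph_arcs(1)[OF assms(1)] by (auto simp: permutation_permutes)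
qed

lemma perm_cycles_rotation:
  assumes G: "finite_connected_graph G \<alpha>" and E: "embedding_of G \<alpha> \<beta> \<gamma>"
  shows "perm_cycles \<beta> (arcs G) = half_edges_at G ` verts G"
proof -
  have cyc: "cyclic_on \<beta> (half_edges_at G v)" if "v \<in> verts G" for v
    using E that by (simp add: embedding_of_def)
  have orb: "orbit \<beta> h = half_edges_at G (tail G h)" if "h \<in> arcs G" for h
    using orbit_cyclic_eq3[OF cyc] finite_connected_graph_arcs(7)[OF G that] that by simp
  show ?thesis
  proof (intro equalityI subsetI)
    fix C assume "C \<in> perm_cycles \<beta> (arcs G)"
    then show "C \<in> half_edges_at G ` verts G"
      using orb finite_connected_graph_arcs(7)[OF G] by (auto simp: perm_cycles_def)
  next
    fix C assume "C \<in> half_edges_at G ` verts G"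
    then obtain v where v: "v \<in> verts G" "C = half_edges_at G v" by blast
    then obtain h where "h \<in> half_edges_at G v" using cyc[of v] unfolding cyclic_on_def by blast
    then have "h \<in> arcs G" "C = orbit \<beta> h" using orb v by auto
    then show "C \<in> perm_cycles \<beta> (arcs G)" by (auto simp: perm_cycles_def)
  qed
qed

lemma card_arcs_eq_twice_edges:
  assumes G: "finite_connected_graph G \<alpha>"
  shows "card (arcs G) = 2 * card (perm_cycles \<alpha> (arcs G))"
proof -
  note g = finite_connected_graph_arcs[OF G]
  have orb: "orbit \<alpha> h = {h, \<alpha> h}" for h
  proof -
    have a: "\<alpha> (\<alpha> h) = h" using g(6) by (metis comp_apply id_apply)
    have "orbit \<alpha> h \<subseteq> {h, \<alpha> h}" by (rule orbit_subset_closed) (auto simp: a)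
    moreover have "\<alpha> h \<in> orbit \<alpha> h" "\<alpha> (\<alpha> h) \<in> orbit \<alpha> h" by (blast intro: orbit.intros)+
    ultimately show ?thesis using a by auto
  qed
  have perm: "permutation \<alpha>" using g(1,4) by (auto simp: permutation_permutes)
  have un: "\<Union> (perm_cycles \<alpha> (arcs G)) = arcs G"
    using permutes_in_image[OF g(4)] by (auto simp: perm_cycles_def orb)
  have "2 * card (perm_cycles \<alpha> (arcs G)) = card (\<Union> (perm_cycles \<alpha> (arcs G)))"
  proof (rule card_partition)
    show "finite (perm_cycles \<alpha> (arcs G))" using g(1) by (rule finite_perm_cycles)
    show "finite (\<Union> (perm_cycles \<alpha> (arcs G)))" using un g(1) by simp
    fix C assume "C \<in> perm_cycles \<alpha> (arcs G)"
    then obtain h where "h \<in> arcs G" "C = {h, \<alpha> h}" by (auto simp: perm_cycles_def orb)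
    then show "card C = 2" using g(5)[of h] by simp
  next
    fix C D assume "C \<in> perm_cycles \<alpha> (arcs G)" "D \<in> perm_cycles \<alpha> (arcs G)" "C \<noteq> D"
    then show "C \<inter> D = {}"
      using orbit_eq_iff[OF perm] unfolding perm_cycles_def by blast
  qed
  then show ?thesis using un by simp
qed

text \<open>
  The genus is given by a definite description, so its equation holds only because the Euler
  characteristic is even: as \<open>\<gamma> = \<alpha> \<circ> \<beta>\<close>, the three cycle
  counts together with three times the number of half edges have an even sum, and the number of half
  edges is even itself.
\<close>
lemma euler_formula:
  assumes G: "finite_connected_graph G \<alpha>" and E: "embedding_of G \<alpha> \<beta> \<gamma>"
  shows "int (card (half_edges_at G ` verts G)) - int (card (perm_cycles \<alpha> (arcs G)))
           + int (card (perm_cycles \<gamma> (arcs G))) = 2 - 2 * genus (arcs G) \<alpha> \<beta> \<gamma>"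
proof -
  note g = finite_connected_graph_arcs[OF G]
  note p = embedding_permutes[OF G E]
  let ?H = "arcs G"
  let ?chi = "int (card (perm_cycles \<beta> ?H)) - int (card (perm_cycles \<alpha> ?H))
    + int (card (perm_cycles \<gamma> ?H))"
  have perm: "permutation \<alpha>" using g(1,4) by (auto simp: permutation_permutes)
  have "\<gamma> = \<alpha> \<circ> \<beta>" using E by (simp add: embedding_of_def)
  then have "evenperm \<gamma> \<longleftrightarrow> evenperm \<alpha> = evenperm \<beta>" using perm p(3) by (simp add: evenperm_comp)
  then have "even ?chi"
    using evenperm_iff_perm_cycles[OF g(1)] g(4) p(1,2) card_arcs_eq_twice_edges[OF G]
    by (auto simp: even_add)
  then obtain k where k: "?chi = 2 * k" by blast
  have "?chi = 2 - 2 * genus ?H \<alpha> \<beta> \<gamma>"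
    unfolding genus_def by (rule theI[of _ "1 - k"]) (use k in auto)
  then show ?thesis by (simp only: perm_cycles_rotation[OF G E])
qed

text \<open>
  Since \<open>\<gamma> = \<alpha> \<circ> \<beta>\<close>, multiplying the rotation on the right by
  a permutation of the half edges at \<open>v\<close> multiplies the face permutation in the same
  way. All re-embeddings below are of this form.
\<close>
lemma embedding_comp_local:
  assumes G: "finite_connected_graph G \<alpha>" and E: "embedding_of G \<alpha> \<beta> \<gamma>" and v: "v \<in> verts G"
    and t: "t permutes half_edges_at G v" and cyc: "cyclic_on (\<beta> \<circ> t) (half_edges_at G v)"
  shows "embedding_of G \<alpha> (\<beta> \<circ> t) (\<gamma> \<circ> t)"
  unfolding embedding_of_def
proof (intro conjI ballI)
  have "t permutes arcs G" using t by (rule permutes_subset) auto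
  then show "\<beta> \<circ> t permutes arcs G" using embedding_permutes(1)[OF G E] by (rule permutes_compose)
  show "\<gamma> \<circ> t = \<alpha> \<circ> (\<beta> \<circ> t)" using E by (simp add: embedding_of_def o_assoc)
  fix u assume u: "u \<in> verts G"
  show "cyclic_on (\<beta> \<circ> t) (half_edges_at G u)"
  proof (cases "u = v")
    case False
    show ?thesis
    proof (rule permutes_comp_preserves_cyclic1[OF t])
      show "cyclic_on \<beta> (half_edges_at G u)" using E u by (simp add: embedding_of_def)
      show "half_edges_at G u \<inter> half_edges_at G v = {}" using False by auto
    qed simp
  qed (use cyc in simp)
qed

lemma genus_bounds:
  assumes G: "finite_connected_graph G \<alpha>" and E: "embedding_of G \<alpha> \<beta> \<gamma>"
  shows "g_min G \<alpha> \<le> genus (arcs G) \<alpha> \<beta> \<gamma>" "genus (arcs G) \<alpha> \<beta> \<gamma> \<le> g_max G \<alpha>"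
proof -
  let ?A = "{genus (arcs G) \<alpha> \<beta> \<gamma> | \<beta> \<gamma>. embedding_of G \<alpha> \<beta> \<gamma>}"
  have "?A \<subseteq> (\<lambda>\<beta>. genus (arcs G) \<alpha> \<beta> (\<alpha> \<circ> \<beta>)) ` {\<beta>. \<beta> permutes arcs G}"
    by (auto simp: embedding_of_def)
  then have "finite ?A"
    using finite_permutations[OF finite_connected_graph_arcs(1)[OF G]] finite_surj by blast
  moreover have "genus (arcs G) \<alpha> \<beta> \<gamma> \<in> ?A" using E by blast
  ultimately show "g_min G \<alpha> \<le> genus (arcs G) \<alpha> \<beta> \<gamma>" "genus (arcs G) \<alpha> \<beta> \<gamma> \<le> g_max G \<alpha>"
    unfolding g_min_def g_max_def by (rule Min_le, rule Max_ge)
qed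

section \<open>Re-embedding at a single vertex\<close>

text \<open>
  Each round of joining three faces at \<open>v\<close> into one removes two faces and raises the
  genus by one.
\<close>
lemma genus_raising_embedding:
  assumes G: "finite_connected_graph G \<alpha>" and E: "embedding_of G \<alpha> \<beta> \<gamma>" and v: "v \<in> verts G"
  shows "\<exists>\<beta>' \<gamma>'. embedding_of G \<alpha> \<beta>' \<gamma>' \<and> genus (arcs G) \<alpha> \<beta>' \<gamma>' =
    genus (arcs G) \<alpha> \<beta> \<gamma> + (int (card (incident_faces G \<gamma> v)) - 1) div 2"
proof -
  let ?S = "half_edges_at G v" and ?q = "card (incident_faces G \<gamma> v)"
  note g = finite_connected_graph_arcs[OF G]
  note p = embedding_permutes[OF G E]
  have sub: "?S \<subseteq> arcs G" by auto
  have cyc: "cyclic_on \<beta> ?S" using E v by (simp add: embedding_of_def)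
  then obtain h where h: "h \<in> ?S" by (auto simp: cyclic_on_def)
  have "orbit \<gamma> h \<in> incident_faces G \<gamma> v"
    using h permutation_self_in_orbit[OF p(4), of h] by (auto simp: incident_faces_def perm_cycles_def)
  moreover have "finite (incident_faces G \<gamma> v)"
    using finite_perm_cycles[OF g(1)] by (simp add: incident_faces_def)
  ultimately have q: "1 \<le> ?q" by (auto simp: Suc_le_eq card_gt_0_iff)
  obtain t where t: "t permutes ?S" "cyclic_on (\<beta> \<circ> t) ?S"
    and faces: "card (perm_cycles (\<gamma> \<circ> t) (arcs G)) + 2 * ((?q - 1) div 2) = card (perm_cycles \<gamma> (arcs G))"
    using join_cycles_in_pairs[OF g(1) sub p(3,4) cyc] unfolding incident_faces_def by blast
  have E': "embedding_of G \<alpha> (\<beta> \<circ> t) (\<gamma> \<circ> t)" using embedding_comp_local[OF G E v t] .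
  have "int ((?q - 1) div 2) = (int ?q - 1) div 2" using q by (simp add: zdiv_int of_nat_diff)
  then have "genus (arcs G) \<alpha> (\<beta> \<circ> t) (\<gamma> \<circ> t) = genus (arcs G) \<alpha> \<beta> \<gamma> + (int ?q - 1) div 2"
    using euler_formula[OF G E] euler_formula[OF G E'] faces by linarith
  then show ?thesis using E' by blast
qed

text \<open>
  Write \<open>s\<close> and \<open>pi\<close> for the local permutations at \<open>v\<close>.
  Multiplying rotation and face permutation by the inverse of \<open>s\<close> cuts the faces at
  \<open>v\<close> into as many pieces as \<open>v\<close> has half edges, while the rotation
  becomes \<open>pi \<circ> inv s = inv D\<close> on the half edges at \<open>v\<close>, which has
  as many cycles as \<open>D\<close>. Each piece contains a single half edge of \<open>v\<close>, so
  \<open>merge_all_cycles\<close> repairs the rotation at the cost of one face less than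
  \<open>D\<close> has cycles. The equation is stated without halving; it shows in particular that
  the numerator in \<open>T1\<close> is even, so that its floor is exact.
\<close>
lemma genus_lowering_embedding:
  assumes G: "finite_connected_graph G \<alpha>" and E: "embedding_of G \<alpha> \<beta> \<gamma>" and v: "v \<in> verts G"
  shows "\<exists>\<beta>' \<gamma>'. embedding_of G \<alpha> \<beta>' \<gamma>' \<and>
    2 * genus (arcs G) \<alpha> \<beta>' \<gamma>' = 2 * genus (arcs G) \<alpha> \<beta> \<gamma>
      - (int (card (half_edges_at G v)) + 1
          - int (size (cycle_type (local_D G \<gamma> \<beta> v) (half_edges_at G v)))
          - int (card (incident_faces G \<gamma> v)))"
proof -
  let ?S = "half_edges_at G v" and ?q = "card (incident_faces G \<gamma> v)"
  note g = finite_connected_graph_arcs[OF G]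
  note p = embedding_permutes[OF G E]
  have sub: "?S \<subseteq> arcs G" by auto
  then have fin: "finite ?S" using g(1) by (rule finite_subset)
  have cyc: "cyclic_on \<beta> ?S" using E v by (simp add: embedding_of_def)
  then have ne: "?S \<noteq> {}" by (auto simp: cyclic_on_def)
  define s where "s = local_s G \<gamma> v"
  define D where "D = local_D G \<gamma> \<beta> v"
  let ?pi = "local_pi G \<beta> v"
  have s: "s permutes ?S" "inv s permutes ?S"
    using perm_delete_outside_permutes[OF p(4) fin] by (auto simp: s_def local_s_def permutes_inv)
  have pi: "?pi permutes ?S"
  proof (rule bij_imp_permutes)
    have "\<beta> ` ?S \<subseteq> ?S" using cyclic_on_inI[OF cyc] by blast
    moreover have "inj_on \<beta> ?S" using p(1) by (metis inj_on_subset permutes_inj subset_UNIV)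
    ultimately have "bij_betw \<beta> ?S ?S" using endo_inj_surj[OF fin] by (simp add: bij_betw_def)
    then show "bij_betw ?pi ?S ?S"
      using bij_betw_cong[of ?S ?pi \<beta> ?S] unfolding local_pi_def
      by (simp add: perm_restrict_simps(1))
    show "?pi x = x" if "x \<notin> ?S" for x
      using that unfolding local_pi_def by (rule perm_restrict_simps)
  qed
  have D: "D = s \<circ> inv ?pi" by (simp add: D_def local_D_def s_def)
  have permD: "permutation D" "inv D permutes ?S"
    using D s pi fin by (auto intro!: permutes_inv permutes_compose permutation_compose
          simp: permutation_permutes)
  have invD: "inv D = ?pi \<circ> inv s"
    using permutes_bij[OF s(1)] permutes_bij[OF pi]
    by (simp add: D o_inv_distrib bij_imp_bij_inv inv_inv_eq)
  let ?b = "\<beta> \<circ> inv s" and ?c = "\<gamma> \<circ> inv s"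
  have b_eq: "?b x = inv D x" if "x \<in> ?S" for x
    using permutes_in_image[OF s(2), of x] that by (simp add: invD local_pi_def perm_restrict_def)
  have closed: "?b x \<in> ?S" if "x \<in> ?S" for x
    using b_eq[OF that] permutes_in_image[OF permD(2), of x] that by simp
  have "orbit ?b x = orbit D x" if "x \<in> ?S" for x
  proof -
    have "orbit ?b x = orbit (inv D) x"
      by (rule orbit_cong0[of _ ?S]) (use that closed b_eq in auto)
    then show ?thesis using orbit_inv_eq[OF permD(1)] by simp
  qed
  then have "perm_cycles ?b ?S = perm_cycles D ?S" by (simp add: perm_cycles_def)
  then have k: "size (cycle_type D ?S) = card (perm_cycles ?b ?S)" by (simp add: cycle_type_def)
  have ps: "permutation (inv s)" using s fin by (auto simp: permutation_permutes)
  \<comment> \<open>No two half edges at \<open>v\<close> share a piece.\<close>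
  have finer: "y \<in> orbit ?b x" if "x \<in> ?S" "y \<in> ?S" "y \<in> orbit ?c x" for x y
  proof -
    have "orbit ?c x \<inter> ?S = {x}"
      using orbit_comp_inv_perm_delete_outside[OF p(4) fin that(1)] by (simp only: s_def local_s_def)
    then have "y = x" using that(2,3) by blast
    then show ?thesis
      using permutation_self_in_orbit[OF permutation_compose[OF p(3) ps]] by (simp only:)
  qed
  obtain t where t: "t permutes ?S" "cyclic_on (?b \<circ> t) ?S"
    and faces: "card (perm_cycles (?c \<circ> t) (arcs G)) + card (perm_cycles ?b ?S)
      = card (perm_cycles ?c (arcs G)) + 1"
    using merge_all_cycles[OF g(1) sub ne permutation_compose[OF p(3) ps]
          permutation_compose[OF p(4) ps] closed finer] by blast
  have "card (perm_cycles ?c (arcs G)) + ?q = card (perm_cycles \<gamma> (arcs G)) + card ?S"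
    using card_perm_cycles_comp_inv_perm_delete_outside[OF g(1) sub p(4)]
    by (simp add: s_def local_s_def incident_faces_def)
  moreover have E': "embedding_of G \<alpha> (\<beta> \<circ> (inv s \<circ> t)) (\<gamma> \<circ> (inv s \<circ> t))"
    using permutes_compose[OF t(1) s(2)] t(2)
    by (intro embedding_comp_local[OF G E v]) (auto simp: o_assoc)
  moreover note euler_formula[OF G E] euler_formula[OF G E'] faces k
  ultimately have "2 * genus (arcs G) \<alpha> (\<beta> \<circ> (inv s \<circ> t)) (\<gamma> \<circ> (inv s \<circ> t))
    = 2 * genus (arcs G) \<alpha> \<beta> \<gamma> - (int (card ?S) + 1 - int (size (cycle_type D ?S)) - int ?q)"
    unfolding o_assoc by linarith
  then show ?thesis using E' unfolding D_def by blast
qed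

theorem theorem4p10:
  fixes G :: "('v, 'h) pre_digraph" and \<alpha> \<beta> \<gamma> :: "'h \<Rightarrow> 'h"
  assumes "finite_connected_graph G \<alpha>"
    and "embedding_of G \<alpha> \<beta> \<gamma>"
  shows "g_min G \<alpha> \<le> genus (arcs G) \<alpha> \<beta> \<gamma> + T1 G \<gamma> \<beta>
       \<and> genus (arcs G) \<alpha> \<beta> \<gamma> + T1 G \<gamma> \<beta> \<le> genus (arcs G) \<alpha> \<beta> \<gamma> + T2 G \<gamma>
       \<and> genus (arcs G) \<alpha> \<beta> \<gamma> + T2 G \<gamma> \<le> g_max G \<alpha>"
proof (intro conjI)
  let ?g = "genus (arcs G) \<alpha>"
  let ?n = "\<lambda>v. int (card (half_edges_at G v))"
  let ?l = "\<lambda>v. int (size (cycle_type (local_D G \<gamma> \<beta> v) (half_edges_at G v)))"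
  let ?q = "\<lambda>v. int (card (incident_faces G \<gamma> v))"
  let ?a = "\<lambda>v. - ((?n v + 1 - ?l v - ?q v) div 2)"
  let ?z = "\<lambda>v. (?q v - 1) div 2"
  note g = finite_connected_graph_arcs[OF assms(1)]
  \<comment> \<open>A vertex attaining the minimum, respectively the maximum, determines where to re-embed.\<close>
  have "T1 G \<gamma> \<beta> \<in> ?a ` verts G"
    unfolding T1_def using g(2,3) by (intro Min_in) auto
  then obtain v where v: "v \<in> verts G" "T1 G \<gamma> \<beta> = ?a v" by blast
  obtain \<beta>' \<gamma>' where E': "embedding_of G \<alpha> \<beta>' \<gamma>'"
    and genus': "2 * ?g \<beta>' \<gamma>' = 2 * ?g \<beta> \<gamma> - (?n v + 1 - ?l v - ?q v)"
    using genus_lowering_embedding[OF assms v(1)] by blast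
  have T1: "?g \<beta>' \<gamma>' = ?g \<beta> \<gamma> + T1 G \<gamma> \<beta>"
    using genus' unfolding v(2) by presburger
  then show "g_min G \<alpha> \<le> ?g \<beta> \<gamma> + T1 G \<gamma> \<beta>"
    using genus_bounds(1)[OF assms(1) E'] by simp
  have "T2 G \<gamma> \<in> ?z ` verts G"
    unfolding T2_def using g(2,3) by (intro Max_in) auto
  then obtain u where u: "u \<in> verts G" "T2 G \<gamma> = ?z u" by blast
  show "?g \<beta> \<gamma> + T2 G \<gamma> \<le> g_max G \<alpha>"
    using genus_raising_embedding[OF assms u(1)] genus_bounds(2)[OF assms(1)] u(2) by metis
  have "finite (half_edges_at G v)" by (rule finite_subset[OF _ g(1)]) auto
  then have "?l v \<le> ?n v"
    by (auto simp: cycle_type_def perm_cycles_def intro!: card_image_le)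
  \<comment> \<open>The numerator of \<open>T1\<close> is even, and it is at least \<open>1 - q\<close> since \<open>D\<close> has at most as many cycles as points.\<close>
  then have "T1 G \<gamma> \<beta> \<le> ?z v" using genus' T1 by presburger
  also have "?z v \<le> T2 G \<gamma>" unfolding T2_def using g(2) v(1) by (intro Max_ge) auto
  finally show "?g \<beta> \<gamma> + T1 G \<gamma> \<beta> \<le> ?g \<beta> \<gamma> + T2 G \<gamma>" by simp
qed

end
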